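(* Let $f+g:X\times Y\to\mathbb R$, $(x,y)\mapsto f(x)+g(y)$, and assume that $\nabla(f+g):X\times Y\to X\times Y$ is $\alpha$-strongly monotone for some $\alpha>0$, i.e. $\langle\nabla(f+g)(u)-\nabla(f+g)(v),u-v\rangle_{X\times Y}\ge\alpha\|u-v\|_{X\times Y}^2$ for all $u,v\in X\times Y$. Assume the set $\Sigma$ of saddle points of $L$ is non-empty, and let $(x,y,\lambda):[0,+\infty)\to X\times Y\times Z$ be a solution of the generalized Arrow--Hurwicz differential system (GAH) with initial data $(x_0,y_0,\lambda_0)\in X\times Y\times Z$. Then, for any $(\xi,\psi,\eta)\in\Sigma$, $$L(x(t),y(t),\eta)-L(\xi,\psi,\lambda(t))=o\Big(\frac1{\sqrt t}\Big)\quad\text{as } t\to+\infty,$$ $$\|(\dot x(t),\dot y(t),\dot\lambda(t))\|=o\Big(\frac1{\sqrt t}\Big)\quad\text{as } t\to+\infty .$$ Moreover, $(x(t),y(t),\lambda(t))$ converges weakly, as $t\to+\infty$, to $\operatorname{proj}_{\Sigma}(x_0,y_0,\lambda_0)\in\Sigma$.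
   Context: $X$, $Y$, $Z$ are real Hilbert spaces; $X\times Y\times Z$ carries the product Hilbert structure $\langle\cdot,\cdot\rangle=\langle\cdot,\cdot\rangle_X+\langle\cdot,\cdot\rangle_Y+\langle\cdot,\cdot\rangle_Z$, with norm $\|\cdot\|$, and $X\times Y$ likewise carries the product structure. Standing assumptions: $f:X\to\mathbb R$ and $g:Y\to\mathbb R$ are convex and continuously differentiable; $\nabla f:X\to X$ and $\nabla g:Y\to Y$ are Lipschitz continuous on bounded sets; $A:X\to Z$ and $B:Y\to Z$ are linear and continuous, with adjoints $A^*,B^*$; $c\in Z$. The Lagrangian is $L:X\times Y\times Z\to\mathbb R$, $L(x,y,\lambda)=f(x)+g(y)+\langle\lambda,Ax+By-c\rangle_Z$. A saddle point of $L$ is a triple $(\bar x,\bar y,\bar\lambda)\in X\times Y\times Z$ with $L(\bar x,\bar y,\lambda)\le L(\bar x,\bar y,\bar\lambda)\le L(x,y,\bar\lambda)$ for all $(x,y,\lambda)\in X\times Y\times Z$; $\Sigma\subset X\times Y\times Z$ denotes the set of all saddle points of $L$ (it is closed and convex), and $\operatorname{proj}_\Sigma$ the orthogonal projection onto it. The system (GAH) is $$\dot x+\nabla f(x)+A^*\lambda=0_X,\qquad \dot y+\nabla g(y)+B^*\lambda=0_Y,\qquad \dot\lambda+c-Ax-By=0_Z,$$ with initial data $(x(0),y(0),\lambda(0))=(x_0,y_0,\lambda_0)\in X\times Y\times Z$; a solution is a function of class $\mathcal C^1$ on $[0,+\infty)$ with values in $X\times Y\times Z$ satisfying the system on $[0,+\infty)$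 with these initial data. *)

theory Defs
  imports "HOL-Analysis.Analysis" "HOL-Library.Landau_Symbols"
begin

text \<open>
  Real Hilbert spaces are types of sort \<open>{real_inner, complete_space}\<close>. The library instances for
  \<open>\<times>\<close> provide the product Hilbert structure. The library constant \<open>adjoint\<close> is defined by
  \<open>A x \<bullet> y = x \<bullet> adjoint A y\<close> on arbitrary inner product types, although its characteristic lemmas
  are only stated for Euclidean spaces.
\<close>

definition continuously_differentiable :: "('a::real_normed_vector \<Rightarrow> real) \<Rightarrow> bool" where
  "continuously_differentiable f \<longleftrightarrow>
     (\<exists>f' :: 'a \<Rightarrow> 'a \<Rightarrow>\<^sub>L real.
        (\<forall>x. (f has_derivative blinfun_apply (f' x)) (at x)) \<and> continuous_on UNIV f')"

definition gradient :: "('a::real_inner \<Rightarrow> real) \<Rightarrow> 'a \<Rightarrow> 'a" where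
  "gradient f x = (THE D. GDERIV f x :> D)"

definition lipschitz_on_bounded_sets :: "('a::metric_space \<Rightarrow> 'b::metric_space) \<Rightarrow> bool" where
  "lipschitz_on_bounded_sets T \<longleftrightarrow> (\<forall>S. bounded S \<longrightarrow> (\<exists>K. K-lipschitz_on S T))"

definition strongly_monotone :: "real \<Rightarrow> ('a::real_inner \<Rightarrow> 'a) \<Rightarrow> bool" where
  "strongly_monotone \<alpha> T \<longleftrightarrow> (\<forall>u v. (T u - T v) \<bullet> (u - v) \<ge> \<alpha> * (norm (u - v))\<^sup>2)"

definition lagrangian ::
  "('x \<Rightarrow> real) \<Rightarrow> ('y \<Rightarrow> real) \<Rightarrow> ('x \<Rightarrow> 'z) \<Rightarrow> ('y \<Rightarrow> 'z) \<Rightarrow> 'z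
     \<Rightarrow> 'x \<Rightarrow> 'y \<Rightarrow> 'z::real_inner \<Rightarrow> real" where
  "lagrangian f g A B c x y l = f x + g y + l \<bullet> (A x + B y - c)"

definition saddle_points :: "('x \<Rightarrow> 'y \<Rightarrow> 'z \<Rightarrow> real) \<Rightarrow> ('x \<times> 'y \<times> 'z) set" where
  "saddle_points L =
     {(x', y', l'). \<forall>x y l. L x' y' l \<le> L x' y' l' \<and> L x' y' l' \<le> L x y l'}"

text \<open>
  The library constant \<open>closest_point\<close> is restricted to \<open>heine_borel\<close> types, that is, to finite
  dimension; the following is its counterpart without that restriction.
\<close>

definition orth_proj :: "'a::metric_space set \<Rightarrow> 'a \<Rightarrow> 'a" where
  "orth_proj S a = (THE p. p \<in> S \<and> (\<forall>q\<in>S. dist a p \<le> dist a q))"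

definition converges_weakly ::
  "('i \<Rightarrow> 'a::real_normed_vector) \<Rightarrow> 'a \<Rightarrow> 'i filter \<Rightarrow> bool" where
  "converges_weakly z w F \<longleftrightarrow>
     (\<forall>\<phi> :: 'a \<Rightarrow> real. bounded_linear \<phi> \<longrightarrow> ((\<lambda>t. \<phi> (z t)) \<longlongrightarrow> \<phi> w) F)"

text \<open>
  Time derivatives are taken within \<open>{0..}\<close>, hence one-sided at \<open>0\<close>; the values of trajectories
  at negative times are irrelevant.
\<close>

definition time_deriv :: "(real \<Rightarrow> 'a::real_normed_vector) \<Rightarrow> real \<Rightarrow> 'a" where
  "time_deriv z t = vector_derivative z (at t within {0..})"

definition C1_on_half_line :: "(real \<Rightarrow> 'a::real_normed_vector) \<Rightarrow> bool" where
  "C1_on_half_line z \<longleftrightarrow>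
     (\<exists>z'. (\<forall>t\<ge>0. (z has_vector_derivative z' t) (at t within {0..})) \<and> continuous_on {0..} z')"

definition GAH_solution ::
  "('x::real_inner \<Rightarrow> real) \<Rightarrow> ('y::real_inner \<Rightarrow> real) \<Rightarrow> ('x \<Rightarrow> 'z::real_inner) \<Rightarrow> ('y \<Rightarrow> 'z) \<Rightarrow> 'z
     \<Rightarrow> 'x \<Rightarrow> 'y \<Rightarrow> 'z \<Rightarrow> (real \<Rightarrow> 'x) \<Rightarrow> (real \<Rightarrow> 'y) \<Rightarrow> (real \<Rightarrow> 'z) \<Rightarrow> bool" where
  "GAH_solution f g A B c x0 y0 l0 x y l \<longleftrightarrow>
     C1_on_half_line (\<lambda>t. (x t, y t, l t)) \<and>
     (\<forall>t\<ge>0. time_deriv x t + gradient f (x t) + adjoint A (l t) = 0 \<and>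
            time_deriv y t + gradient g (y t) + adjoint B (l t) = 0 \<and>
            time_deriv l t + c - A (x t) - B (y t) = 0) \<and>
     x 0 = x0 \<and> y 0 = y0 \<and> l 0 = l0"

end

theory Submission
  imports Defs
begin

text \<open>
  With \<open>u = (x, y)\<close>, \<open>F = \<nabla>(f + g)\<close>, \<open>K u = A x + B y\<close> the system reads \<open>z' = - G z\<close> for
  \<open>z = (u, \<lambda>)\<close> and the monotone operator \<open>G (u, \<lambda>) = (F u + K\<^sup>* \<lambda>, c - K u)\<close>, whose zeros are the
  saddle points. Trajectories do not move apart, hence the speed is nonincreasing. Strong
  monotonicity makes the distance to a translate dissipate the primal speed, and the distance to a
  saddle point dissipate \<open>u - \<xi>\<close>, hence the dual speed \<open>K (u - \<xi>)\<close>; so the squared speed is integrable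
  and, being nonincreasing, is \<open>o(1/t)\<close>. The gap is bounded by the speed times the
  distance to the saddle point, and strong monotonicity gives \<open>u \<rightarrow> \<xi>\<close>.

  Since \<open>\<lambda>'\<close> lies in the range of \<open>K\<close>, the component of \<open>\<lambda>\<close> in \<open>ker K\<^sup>*\<close> is constant, while
  \<open>K\<^sup>* \<lambda> = - u' - F u\<close> converges to \<open>- F \<xi>\<close>; together these identify the weak limit without any weak
  compactness argument.
\<close>

section \<open>Hilbert spaces and gradients\<close>

text \<open>A minimizing sequence is Cauchy by the parallelogram identity, because midpoints of its
  terms stay in \<open>S\<close>; completeness supplies the limit and closedness keeps it in
  \<open>S\<close>.\<close>

lemma closed_subspace_nearest_point:
  fixes S :: "'a::{real_inner, complete_space} set"
  assumes "closed S" and "subspace S"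
  obtains p where "p \<in> S" and "\<And>q. q \<in> S \<Longrightarrow> norm (a - p) \<le> norm (a - q)"
proof -
  define d where "d = infdist a S"
  have ne: "S \<noteq> {}"
    using subspace_0[OF assms(2)] by auto
  have d_le: "d \<le> norm (a - q)" if "q \<in> S" for q
    using infdist_le[OF that, of a] by (simp add: d_def dist_norm)
  have d0: "d \<ge> 0"
    by (simp add: d_def infdist_nonneg)
  have "\<exists>q\<in>S. norm (a - q) < d + inverse (real (Suc n))" for n
  proof (rule ccontr)
    assume "\<not> ?thesis"
    then have "d + inverse (real (Suc n)) \<le> infdist a S"
      unfolding infdist_def using ne by (auto intro!: cINF_greatest simp: not_less dist_norm)
    then show False
      by (simp add: d_def)
  qed
  then obtain p where pS: "\<And>n. p n \<in> S"
      and pd: "\<And>n. norm (a - p n) < d + inverse (real (Suc n))"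
    by metis
  have mid: "(norm (p m - p n))\<^sup>2 \<le> 2 * (norm (a - p m))\<^sup>2 + 2 * (norm (a - p n))\<^sup>2 - 4 * d\<^sup>2"
    for m n
  proof -
    have "(1/2) *\<^sub>R (p m + p n) \<in> S"
      using assms(2) pS by (simp add: subspace_add subspace_scale)
    then have "d \<le> norm (a - (1/2) *\<^sub>R (p m + p n))"
      by (rule d_le)
    then have "d\<^sup>2 \<le> (norm (a - (1/2) *\<^sub>R (p m + p n)))\<^sup>2"
      using d0 by (simp add: power_mono)
    moreover have "(norm (p m - p n))\<^sup>2 + 4 * (norm (a - (1/2) *\<^sub>R (p m + p n)))\<^sup>2
        = 2 * (norm (a - p m))\<^sup>2 + 2 * (norm (a - p n))\<^sup>2"
      by (simp add: power2_norm_eq_inner inner_simps inner_commute algebra_simps)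
    ultimately show ?thesis by linarith
  qed
  \<comment> \<open>Inserting the bound \<open>d + e\<close> for both distances into
    \<open>mid\<close> leaves \<open>8 * d * e + 4 * e\<^sup>2\<close>; since \<open>e\<close> is at
    most 1, this is linear in \<open>e\<close>.\<close>
  have near: "(norm (p m - p n))\<^sup>2 \<le> (8 * d + 4) * inverse (real (Suc N))"
    if "m \<ge> N" "n \<ge> N" for m n N
  proof -
    define e where "e = inverse (real (Suc N))"
    have e: "0 < e" "e \<le> 1"
      by (auto simp: e_def field_simps)
    have sq: "(norm (a - p k))\<^sup>2 \<le> (d + e)\<^sup>2" if "k \<ge> N" for k
    proof -
      have "inverse (real (Suc k)) \<le> e"
        using that by (simp add: e_def)
      then have "norm (a - p k) \<le> d + e"
        using pd[of k] by linarith
      then show ?thesis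
        by (simp add: power_mono)
    qed
    have "e\<^sup>2 \<le> e"
      using e by (simp add: power2_eq_square mult_left_le)
    moreover have "(d + e)\<^sup>2 = d\<^sup>2 + 2 * (d * e) + e\<^sup>2"
      by (simp add: power2_eq_square algebra_simps)
    moreover have "(norm (p m - p n))\<^sup>2 \<le> 4 * (d + e)\<^sup>2 - 4 * d\<^sup>2"
      using mid[of m n] sq[OF that(1)] sq[OF that(2)] by linarith
    ultimately have "(norm (p m - p n))\<^sup>2 \<le> 8 * (d * e) + 4 * e"
      by linarith
    then show ?thesis
      by (simp add: e_def algebra_simps)
  qed
  have "Cauchy p"
  proof (rule metric_CauchyI)
    fix r :: real assume r: "r > 0"
    have pos: "8 * d + 4 > 0"
      using d0 by linarith
    then obtain N where N: "inverse (real (Suc N)) < r\<^sup>2 / (8 * d + 4)"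
      using reals_Archimedean[of "r\<^sup>2 / (8 * d + 4)"] r by auto
    have "dist (p m) (p n) < r" if "m \<ge> N" "n \<ge> N" for m n
    proof -
      have "(8 * d + 4) * inverse (real (Suc N)) < r\<^sup>2"
        using N pos by (metis pos_less_divide_eq mult.commute)
      then have "(norm (p m - p n))\<^sup>2 < r\<^sup>2"
        using near[OF that] by linarith
      then show ?thesis
        unfolding dist_norm by (rule power2_less_imp_less) (use r in simp)
    qed
    then show "\<exists>M. \<forall>m\<ge>M. \<forall>n\<ge>M. dist (p m) (p n) < r"
      by blast
  qed
  then obtain q where q: "p \<longlonglongrightarrow> q"
    using Cauchy_convergent convergent_def by blast
  have "q \<in> S"
    using closed_sequentially[OF assms(1) _ q] pS by blast
  moreover have "norm (a - q) \<le> d"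
  proof (rule LIMSEQ_le)
    show "(\<lambda>n. norm (a - p n)) \<longlonglongrightarrow> norm (a - q)"
      by (intro tendsto_intros q)
    show "(\<lambda>n. d + inverse (real (Suc n))) \<longlonglongrightarrow> d"
      using tendsto_add[OF tendsto_const[of d] LIMSEQ_inverse_real_of_nat] by simp
    show "\<exists>N. \<forall>n\<ge>N. norm (a - p n) \<le> d + inverse (real (Suc n))"
      using pd less_imp_le by blast
  qed
  ultimately show thesis
    using that[of q] d_le by force
qed

lemma closed_subspace_orthogonal_decomposition:
  fixes S :: "'a::{real_inner, complete_space} set"
  assumes "closed S" and "subspace S"
  obtains p where "p \<in> S" and "\<And>s. s \<in> S \<Longrightarrow> (a - p) \<bullet> s = 0"
proof -
  obtain p where p: "p \<in> S" and near: "\<And>q. q \<in> S \<Longrightarrow> norm (a - p) \<le> norm (a - q)"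
    using closed_subspace_nearest_point[OF assms] by blast
  have "(a - p) \<bullet> s = 0" if s: "s \<in> S" for s
  proof (cases "s = 0")
    case False
    \<comment> \<open>This \<open>t\<close> minimizes the distance from \<open>a\<close> to the line
      through \<open>p\<close> in direction \<open>s\<close>. Moving there would lower the squared
      distance by \<open>((a - p) \<bullet> s)\<^sup>2 / (s \<bullet> s)\<close>, so this amount
      must vanish.\<close>
    define t where "t = ((a - p) \<bullet> s) / (s \<bullet> s)"
    have ss: "s \<bullet> s > 0"
      using False by simp
    have "p + t *\<^sub>R s \<in> S"
      using assms(2) p s by (simp add: subspace_add subspace_scale)
    then have "(norm (a - p))\<^sup>2 \<le> (norm (a - (p + t *\<^sub>R s)))\<^sup>2"
      using near by (simp add: power_mono)
    also have "a - (p + t *\<^sub>R s) = (a - p) - t *\<^sub>R s"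
      by simp
    also have "(norm \<dots>)\<^sup>2 = (norm (a - p))\<^sup>2 - 2 * t * ((a - p) \<bullet> s) + t * (t * (s \<bullet> s))"
      unfolding power2_norm_eq_inner inner_diff_left[of "a - p"] inner_diff_right[of _ "a - p"]
      by (simp add: inner_commute)
    also have "t * (s \<bullet> s) = (a - p) \<bullet> s"
      using ss by (simp add: t_def)
    finally have "t * ((a - p) \<bullet> s) \<le> 0"
      by (simp add: algebra_simps)
    then have "((a - p) \<bullet> s)\<^sup>2 \<le> 0"
      using ss by (simp add: t_def power2_eq_square divide_le_0_iff)
    then show ?thesis by simp
  qed simp
  with p that show thesis by blast
qed

text \<open>A vector \<open>n\<close> orthogonal to the kernel of \<open>\<phi>\<close> represents
  it up to scaling, since every \<open>v\<close> differs from a multiple of \<open>n\<close> by a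
  kernel element.\<close>

lemma riesz_representation:
  fixes \<phi> :: "'a::{real_inner, complete_space} \<Rightarrow> real"
  assumes "bounded_linear \<phi>"
  obtains w where "\<And>v. \<phi> v = v \<bullet> w"
proof (cases "\<forall>v. \<phi> v = 0")
  case True
  then show thesis using that[of 0] by simp
next
  case False
  interpret \<phi>: bounded_linear \<phi> by fact
  obtain a where a: "\<phi> a \<noteq> 0"
    using False by blast
  define S where "S = {v. \<phi> v = 0}"
  have "closed S"
    unfolding S_def by (intro closed_Collect_eq continuous_intros \<phi>.continuous_on)
  moreover have "subspace S"
    by (auto simp: S_def subspace_def \<phi>.zero \<phi>.add \<phi>.scaleR)
  ultimately obtain p where p: "p \<in> S" "\<And>s. s \<in> S \<Longrightarrow> (a - p) \<bullet> s = 0"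
    using closed_subspace_orthogonal_decomposition by blast
  define n where "n = a - p"
  have n: "\<phi> n \<noteq> 0" "n \<noteq> 0"
    using a p(1) by (auto simp: n_def S_def \<phi>.diff)
  have "\<phi> v = v \<bullet> ((\<phi> n / (n \<bullet> n)) *\<^sub>R n)" for v
  proof -
    have "v - (\<phi> v / \<phi> n) *\<^sub>R n \<in> S"
      using n by (simp add: S_def \<phi>.diff \<phi>.scaleR)
    then have "n \<bullet> (v - (\<phi> v / \<phi> n) *\<^sub>R n) = 0"
      using p(2) by (simp add: n_def)
    then show ?thesis
      using n by (simp add: inner_simps inner_commute field_simps)
  qed
  then show thesis by (rule that)
qed

text \<open>The Riesz vectors of the functionals \<open>\<lambda>v. A v \<bullet> w\<close> form a
  map with the adjoint property, and \<open>adjoint_unique\<close> identifies that map with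
  \<open>adjoint A\<close>.\<close>

lemma adjoint_bounded_linear_works:
  fixes A :: "'a::{real_inner, complete_space} \<Rightarrow> 'b::real_inner"
  assumes "bounded_linear A"
  shows "A v \<bullet> w = v \<bullet> adjoint A w"
proof -
  have "\<exists>q. \<forall>v. A v \<bullet> w = v \<bullet> q" for w
  proof -
    have "bounded_linear (\<lambda>v. A v \<bullet> w)"
      by (rule bounded_linear_compose[OF bounded_linear_inner_left assms])
    then show ?thesis
      using riesz_representation by metis
  qed
  then obtain A' where "\<forall>v w. A v \<bullet> w = v \<bullet> A' w"
    by metis
  then show ?thesis
    using adjoint_unique by metis
qed

section \<open>Gradients and convexity\<close>

lemma GDERIV_unique:
  assumes "GDERIV f x :> D" and "GDERIV f x :> D'"
  shows "D = D'"
proof -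
  have "(\<lambda>h. h \<bullet> D) = (\<lambda>h. h \<bullet> D')"
    using assms unfolding gderiv_def by (rule has_derivative_unique)
  then have "\<forall>h. h \<bullet> D = h \<bullet> D'"
    by metis
  then show ?thesis
    by (simp add: vector_eq_ldot)
qed

lemma gradient_eq:
  assumes "GDERIV f x :> D"
  shows "gradient f x = D"
  unfolding gradient_def using assms GDERIV_unique by blast

text \<open>The derivative at \<open>x\<close> is a bounded functional, so its Riesz vector is a
  gradient; uniqueness makes it the value of the description operator in
  \<open>gradient\<close>.\<close>

lemma GDERIV_gradient:
  fixes f :: "'a::{real_inner, complete_space} \<Rightarrow> real"
  assumes "continuously_differentiable f"
  shows "GDERIV f x :> gradient f x"
proof -
  obtain f' where f': "(f has_derivative blinfun_apply (f' x)) (at x)"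
    using assms by (auto simp: continuously_differentiable_def)
  obtain w where "\<And>v. blinfun_apply (f' x) v = v \<bullet> w"
    using riesz_representation[OF blinfun.bounded_linear_right] by blast
  then have "blinfun_apply (f' x) = (\<lambda>v. v \<bullet> w)"
    by (simp add: fun_eq_iff)
  then have "GDERIV f x :> w"
    using f' by (simp add: gderiv_def)
  with gradient_eq show ?thesis by metis
qed

lemma GDERIV_separable_sum:
  assumes "GDERIV f a :> Df" and "GDERIV g b :> Dg"
  shows "GDERIV (\<lambda>(u, v). f u + g v) (a, b) :> (Df, Dg)"
proof -
  have "((\<lambda>p. f (fst p)) has_derivative (\<lambda>h. fst h \<bullet> Df)) (at (a, b))"
    by (rule has_derivative_compose[of fst fst])
      (use assms(1) in \<open>auto simp: gderiv_def intro: derivative_intros\<close>)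
  moreover have "((\<lambda>p. g (snd p)) has_derivative (\<lambda>h. snd h \<bullet> Dg)) (at (a, b))"
    by (rule has_derivative_compose[of snd snd])
      (use assms(2) in \<open>auto simp: gderiv_def intro: derivative_intros\<close>)
  ultimately show ?thesis
    unfolding gderiv_def case_prod_beta inner_prod_def fst_conv snd_conv
    by (rule has_derivative_add)
qed

text \<open>Restricting \<open>h\<close> to the line through \<open>u\<close> and \<open>v\<close>
  reduces this to the tangent inequality for a convex function of one real variable, taken at 0 and
  evaluated at 1.\<close>

lemma convex_above_gradient:
  fixes h :: "'a::real_inner \<Rightarrow> real"
  assumes "convex_on UNIV h" and "GDERIV h u :> D"
  shows "h v \<ge> h u + D \<bullet> (v - u)"
proof -
  define \<gamma> where "\<gamma> s = h (u + s *\<^sub>R (v - u))" for s :: real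
  have "convex_on UNIV \<gamma>"
  proof (rule convex_onI)
    fix t s r :: real assume "0 < t" "t < 1"
    have "u + ((1 - t) *\<^sub>R s + t *\<^sub>R r) *\<^sub>R (v - u)
        = (1 - t) *\<^sub>R (u + s *\<^sub>R (v - u)) + t *\<^sub>R (u + r *\<^sub>R (v - u))"
      by (simp add: algebra_simps)
    then show "\<gamma> ((1 - t) *\<^sub>R s + t *\<^sub>R r) \<le> (1 - t) * \<gamma> s + t * \<gamma> r"
      using convex_onD[OF assms(1), of t] \<open>0 < t\<close> \<open>t < 1\<close> by (simp add: \<gamma>_def)
  qed simp
  moreover have "(\<gamma> has_field_derivative (D \<bullet> (v - u))) (at 0)"
  proof -
    have "((\<lambda>s. u + s *\<^sub>R (v - u)) has_derivative (\<lambda>s. s *\<^sub>R (v - u))) (at 0)"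
      by (auto intro!: derivative_eq_intros)
    then have "(\<gamma> has_derivative (\<lambda>s. (s *\<^sub>R (v - u)) \<bullet> D)) (at 0)"
      unfolding \<gamma>_def
      by (rule has_derivative_compose) (use assms(2) in \<open>simp add: gderiv_def\<close>)
    moreover have "(\<lambda>s. (s *\<^sub>R (v - u)) \<bullet> D) = (*) (D \<bullet> (v - u))"
      by (simp add: fun_eq_iff inner_commute)
    ultimately show ?thesis
      by (simp add: has_field_derivative_def)
  qed
  ultimately have "\<gamma> 1 - \<gamma> 0 \<ge> (D \<bullet> (v - u)) * (1 - 0)"
    by (intro convex_on_imp_above_tangent[of UNIV]) auto
  then show ?thesis
    by (simp add: \<gamma>_def)
qed

section \<open>Real analysis and orthogonality\<close>

text \<open>Mean value theorem in the form used for dissipation estimates; derivatives within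
  \<open>{0..}\<close> let \<open>s\<close> be 0.\<close>

lemma derivative_upper_bound:
  fixes \<phi> :: "real \<Rightarrow> real"
  assumes "0 \<le> s" and "s \<le> t"
    and deriv: "\<And>r. 0 \<le> r \<Longrightarrow> (\<phi> has_real_derivative \<phi>' r) (at r within {0..})"
    and bound: "\<And>r. s \<le> r \<Longrightarrow> r \<le> t \<Longrightarrow> \<phi>' r \<le> b"
  shows "\<phi> t - \<phi> s \<le> b * (t - s)"
proof (cases "s = t")
  case False
  then have st: "s < t" using assms by simp
  have "(\<phi> has_derivative (*) (\<phi>' r)) (at r within {s..t})" if "s \<le> r" for r
    using deriv[of r] that \<open>0 \<le> s\<close> unfolding has_field_derivative_def
    by (auto intro: has_derivative_subset)
  then obtain r where r: "r \<in> {s<..<t}" "\<phi> t - \<phi> s = \<phi>' r * (t - s)"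
    using mvt_simple[OF st, of \<phi> "\<lambda>r. (*) (\<phi>' r)"] by blast
  then show ?thesis
    using bound[of r] by (simp add: mult_right_mono)
qed simp

lemma vector_derivative_norm_bound:
  fixes w :: "real \<Rightarrow> 'a::real_normed_vector"
  assumes "0 \<le> s" and "s \<le> t"
    and deriv: "\<And>r. 0 \<le> r \<Longrightarrow> (w has_vector_derivative w' r) (at r within {0..})"
    and bound: "\<And>r. s \<le> r \<Longrightarrow> r \<le> t \<Longrightarrow> norm (w' r) \<le> b"
  shows "norm (w t - w s) \<le> b * (t - s)"
proof -
  have "norm (w t - w s) \<le> b * norm (t - s)"
  proof (rule differentiable_bound)
    show "(w has_derivative (\<lambda>h. h *\<^sub>R w' r)) (at r within {s..t})" if "r \<in> {s..t}" for r
      using deriv[of r] that \<open>0 \<le> s\<close> unfolding has_vector_derivative_def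
      by (auto intro: has_derivative_subset)
    show "onorm (\<lambda>h. h *\<^sub>R w' r) \<le> b" if "r \<in> {s..t}" for r
      using bound[of r] that by (intro onorm_le) (simp add: mult.commute[of b] mult_left_mono)
  qed (use assms in auto)
  then show ?thesis
    using \<open>s \<le> t\<close> by simp
qed

lemma antimono_bounded_below_tendsto:
  fixes V :: "real \<Rightarrow> real"
  assumes nonneg: "\<And>t. 0 \<le> t \<Longrightarrow> 0 \<le> V t"
    and decr: "\<And>s t. 0 \<le> s \<Longrightarrow> s \<le> t \<Longrightarrow> V t \<le> V s"
  obtains v where "(V \<longlongrightarrow> v) at_top"
proof
  have bdd: "bdd_below (V ` {0..})"
    using nonneg by (auto intro!: bdd_belowI[of _ 0])
  show "(V \<longlongrightarrow> (INF t\<in>{0..}. V t)) at_top"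
  proof (rule order_tendstoI)
    fix a assume a: "a < (INF t\<in>{0..}. V t)"
    have "\<forall>\<^sub>F t in at_top. (0::real) \<le> t"
      by (rule eventually_ge_at_top)
    then show "\<forall>\<^sub>F t in at_top. a < V t"
      by eventually_elim (use a cINF_lower[OF bdd] in force)
  next
    fix a assume "(INF t\<in>{0..}. V t) < a"
    then obtain s where s: "0 \<le> s" "V s < a"
      using cINF_less_iff[of "{0..}" V a] bdd by auto
    have "\<forall>\<^sub>F t in at_top. s \<le> t"
      by (rule eventually_ge_at_top)
    then show "\<forall>\<^sub>F t in at_top. V t < a"
      by eventually_elim (use s decr in force)
  qed
qed

text \<open>Replacing \<open>w\<close> by a nearby \<open>s\<close> in \<open>S\<close> changes the
  inner product by at most the bound on \<open>e\<close> times their distance, uniformly in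
  \<open>t\<close>.\<close>

lemma tendsto_inner_closure:
  fixes S :: "'a::real_inner set"
  assumes w: "w \<in> closure S"
    and bounded: "\<forall>\<^sub>F t in F. norm (e t) \<le> C"
    and tendsto: "\<And>s. s \<in> S \<Longrightarrow> ((\<lambda>t. e t \<bullet> s) \<longlongrightarrow> 0) F"
  shows "((\<lambda>t. e t \<bullet> w) \<longlongrightarrow> 0) F"
proof (rule tendstoI)
  fix r :: real assume "r > 0"
  \<comment> \<open>The maximum and the added 1 make \<open>C'\<close> positive whatever the sign of
    \<open>C\<close>, so that \<open>r / (2 * C')\<close> is a positive tolerance.\<close>
  define C' where "C' = max C 0 + 1"
  have C': "C' > 0"
    by (simp add: C'_def)
  obtain s where s: "s \<in> S" "dist s w < r / (2 * C')"
    using w \<open>r > 0\<close> C' unfolding closure_approachable by (metis divide_pos_pos mult_pos_pos zero_less_numeral)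
  have "\<forall>\<^sub>F t in F. dist (e t \<bullet> s) 0 < r / 2"
    using tendsto[OF s(1)] \<open>r > 0\<close> by (intro tendstoD) auto
  with bounded show "\<forall>\<^sub>F t in F. dist (e t \<bullet> w) 0 < r"
  proof eventually_elim
    case (elim t)
    have "\<bar>e t \<bullet> (w - s)\<bar> \<le> norm (e t) * norm (w - s)"
      by (rule Cauchy_Schwarz_ineq2)
    also have "\<dots> \<le> C' * (r / (2 * C'))"
      using elim(1) s(2) C' by (intro mult_mono) (auto simp: C'_def dist_norm norm_minus_commute)
    also have "\<dots> = r / 2"
      using C' by simp
    finally have "\<bar>e t \<bullet> w - e t \<bullet> s\<bar> \<le> r / 2"
      by (simp add: inner_diff_right)
    with elim(2) show ?case
      unfolding dist_real_def diff_0_right by linarith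
  qed
qed

lemma closure_subspace:
  fixes S :: "'a::real_normed_vector set"
  assumes "subspace S"
  shows "subspace (closure S)"
proof (rule subspaceI)
  show "0 \<in> closure S"
    using subspace_0[OF assms] closure_subset by blast
next
  fix a b assume "a \<in> closure S" "b \<in> closure S"
  then obtain u v where u: "\<forall>n. u n \<in> S" "u \<longlonglongrightarrow> a" and v: "\<forall>n. v n \<in> S" "v \<longlonglongrightarrow> b"
    unfolding closure_sequential by blast
  have "\<forall>n. u n + v n \<in> S"
    using assms u(1) v(1) by (simp add: subspace_add)
  then show "a + b \<in> closure S"
    unfolding closure_sequential using tendsto_add[OF u(2) v(2)] by (intro exI conjI)
next
  fix r :: real and a assume "a \<in> closure S"
  then obtain u where u: "\<forall>n. u n \<in> S" "u \<longlonglongrightarrow> a"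
    unfolding closure_sequential by blast
  have "\<forall>n. r *\<^sub>R u n \<in> S"
    using assms u(1) by (simp add: subspace_scale)
  then show "r *\<^sub>R a \<in> closure S"
    unfolding closure_sequential using tendsto_scaleR[OF tendsto_const u(2)] by (intro exI conjI)
qed

lemma fst_norm_le: "norm (fst q) \<le> norm q" for q :: "'a::real_normed_vector \<times> 'b::real_normed_vector"
  by (metis norm_fst_le prod.collapse)

section \<open>Strongly monotone saddle flows\<close>

text \<open>\<open>K'\<close> enters only through the adjoint identity, which already determines it
  and makes it additive. Completeness is asked of the dual space, where projections onto the closed
  range of \<open>K\<close> are taken.\<close>

locale strongly_monotone_saddle_flow =
  fixes F :: "'u::real_inner \<Rightarrow> 'u" and K :: "'u \<Rightarrow> 'z::{real_inner, complete_space}"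
    and K' :: "'z \<Rightarrow> 'u" and c :: 'z and \<alpha> :: real
  assumes \<alpha>_pos: "0 < \<alpha>"
    and strongly_monotone: "strongly_monotone \<alpha> F"
    and bounded_linear: "bounded_linear K"
    and adjoint: "K v \<bullet> w = v \<bullet> K' w"
begin

text \<open>When \<open>F\<close> is the gradient of \<open>H\<close>, this is the primal gradient
  of the Lagrangian paired with minus its dual gradient; the sign makes the coupling skew.\<close>

definition G :: "'u \<times> 'z \<Rightarrow> 'u \<times> 'z" where
  "G p = (F (fst p) + K' (snd p), c - K (fst p))"

definition flow :: "(real \<Rightarrow> 'u \<times> 'z) \<Rightarrow> bool" where
  "flow z \<longleftrightarrow> (\<forall>t\<ge>0. (z has_vector_derivative - G (z t)) (at t within {0..}))"

text \<open>The coupling is skew: the contributions of \<open>K'\<close> and of \<open>- K\<close>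
  cancel through the adjoint identity. Monotonicity of \<open>G\<close> thus sees only the primal
  component.\<close>

lemma inner_G_diff:
  "(G p - G q) \<bullet> (p - q) = (F (fst p) - F (fst q)) \<bullet> (fst p - fst q)"
proof -
  interpret K: bounded_linear K by (rule bounded_linear)
  have "(G p - G q) \<bullet> (p - q) = (F (fst p) - F (fst q)) \<bullet> (fst p - fst q)
      + ((fst p - fst q) \<bullet> K' (snd p) - (fst p - fst q) \<bullet> K' (snd q))
      + (K (fst q) - K (fst p)) \<bullet> (snd p - snd q)"
    by (simp add: G_def inner_prod_def inner_simps inner_commute)
  also have "\<dots> = (F (fst p) - F (fst q)) \<bullet> (fst p - fst q)"
    unfolding adjoint[symmetric] by (simp add: K.diff inner_simps)
  finally show ?thesis .
qed

lemma G_strongly_monotone_fst: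
  "\<alpha> * (norm (fst p - fst q))\<^sup>2 \<le> (G p - G q) \<bullet> (p - q)"
  using strongly_monotone by (simp add: inner_G_diff strongly_monotone_def)

lemma K'_diff: "K' (a - b) = K' a - K' b"
proof -
  have "v \<bullet> K' (a - b) = v \<bullet> (K' a - K' b)" for v
    unfolding inner_diff_right adjoint[symmetric] ..
  then show ?thesis
    using vector_eq_ldot[of "K' (a - b)" "K' a - K' b"] by blast
qed

lemma equilibrium_fst_unique:
  assumes "G p = 0" and "G q = 0"
  shows "fst p = fst q"
proof -
  have "\<alpha> * (norm (fst p - fst q))\<^sup>2 \<le> 0"
    using G_strongly_monotone_fst[of p q] assms by simp
  then show ?thesis
    using \<alpha>_pos by (simp add: mult_le_0_iff)
qed

text \<open>All equilibria share their primal part, and the first equation then fixes the image of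
  the multiplier under \<open>K'\<close>. Hence two multipliers differ by an element of the kernel
  of \<open>K'\<close>.\<close>

lemma equilibrium_snd_diff:
  assumes "G p = 0" and "G q = 0"
  shows "K' (snd p - snd q) = 0"
proof -
  have "K' (snd r) = fst (G r) - F (fst r)" for r
    by (simp add: G_def)
  then show ?thesis
    using assms equilibrium_fst_unique[OF assms] by (simp add: K'_diff)
qed

lemma saddle_imp_equilibrium:
  assumes deriv: "GDERIV H u :> F u"
    and dual: "\<And>l. H u + l \<bullet> (K u - c) \<le> H u + \<eta> \<bullet> (K u - c)"
    and primal: "\<And>v. H u + \<eta> \<bullet> (K u - c) \<le> H v + \<eta> \<bullet> (K v - c)"
  shows "G (u, \<eta>) = 0"
proof -
  interpret K: bounded_linear K by (rule bounded_linear)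
  \<comment> \<open>Raising the multiplier by the residual itself turns the dual inequality into a
    bound on the squared residual, which forces feasibility. The primal inequality then gives
    stationarity by Fermat's rule.\<close>
  have "(K u - c) \<bullet> (K u - c) \<le> 0"
    using dual[of "\<eta> + (K u - c)"] by (simp only: inner_add_left)
  then have Ku: "K u = c"
    by (metis inner_eq_zero_iff inner_ge_zero order_antisym right_minus_eq)
  have "((\<lambda>v. H v + \<eta> \<bullet> (K v - c)) has_derivative (\<lambda>h. h \<bullet> F u + \<eta> \<bullet> (K h - 0))) (at u)"
    using deriv[unfolded gderiv_def]
    by (intro has_derivative_add has_derivative_inner_right has_derivative_diff
        has_derivative_const bounded_linear_imp_has_derivative bounded_linear)
  then have "(\<lambda>h. h \<bullet> F u + \<eta> \<bullet> (K h - 0)) = (\<lambda>h. 0)"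
    by (rule has_derivative_local_min) (simp add: primal)
  then have "h \<bullet> F u + \<eta> \<bullet> K h = 0" for h
    by (metis diff_0_right)
  then have "h \<bullet> (F u + K' \<eta>) = 0" for h
    by (simp add: inner_add_right adjoint[symmetric] inner_commute)
  from this[of "F u + K' \<eta>"] have "F u + K' \<eta> = 0"
    by simp
  with Ku show ?thesis
    by (simp add: G_def zero_prod_def)
qed

section \<open>Distances between trajectories and the speed\<close>

lemma dist_sq_derivative:
  assumes "flow z" and "flow w" and "0 \<le> t"
  shows "((\<lambda>t. (norm (z t - w t))\<^sup>2) has_real_derivative
           - 2 * ((G (z t) - G (w t)) \<bullet> (z t - w t))) (at t within {0..})"
proof -
  have "((\<lambda>t. z t - w t) has_derivative (\<lambda>h. h *\<^sub>R (- G (z t) - - G (w t)))) (at t within {0..})"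
    using assms unfolding flow_def has_vector_derivative_def[symmetric]
    by (intro has_vector_derivative_diff) auto
  from has_derivative_inner[OF this this]
  have "((\<lambda>t. (z t - w t) \<bullet> (z t - w t)) has_derivative
      (\<lambda>h. (z t - w t) \<bullet> (h *\<^sub>R (- G (z t) - - G (w t))) + (h *\<^sub>R (- G (z t) - - G (w t))) \<bullet> (z t - w t)))
      (at t within {0..})" .
  moreover have "(\<lambda>h. (z t - w t) \<bullet> (h *\<^sub>R (- G (z t) - - G (w t)))
        + (h *\<^sub>R (- G (z t) - - G (w t))) \<bullet> (z t - w t))
      = (*) (- 2 * ((G (z t) - G (w t)) \<bullet> (z t - w t)))"
    by (simp add: fun_eq_iff inner_simps inner_commute algebra_simps)
  ultimately show ?thesis
    by (simp add: has_field_derivative_def power2_norm_eq_inner)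
qed

lemma flow_dist_decreasing:
  assumes "flow z" and "flow w" and "0 \<le> s" and "s \<le> t"
  shows "norm (z t - w t) \<le> norm (z s - w s)"
proof -
  have "- 2 * ((G p - G q) \<bullet> (p - q)) \<le> 0" for p q
  proof -
    have "0 \<le> \<alpha> * (norm (fst p - fst q))\<^sup>2"
      using \<alpha>_pos by simp
    with G_strongly_monotone_fst[of p q] show ?thesis by linarith
  qed
  from derivative_upper_bound[OF assms(3,4) dist_sq_derivative[OF assms(1,2)] this]
  have "(norm (z t - w t))\<^sup>2 \<le> (norm (z s - w s))\<^sup>2"
    by simp
  then show ?thesis
    by (rule power2_le_imp_le) simp
qed

lemma flow_const: "G p = 0 \<Longrightarrow> flow (\<lambda>t. p)"
  by (simp add: flow_def)

lemma flow_shift: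
  assumes "flow z" and "0 \<le> h"
  shows "flow (\<lambda>t. z (t + h))"
  unfolding flow_def
proof (intro allI impI)
  fix t :: real assume "0 \<le> t"
  have "((\<lambda>t. t + h) has_vector_derivative 1) (at t within {0..})"
    using has_vector_derivative_add[OF has_vector_derivative_id has_vector_derivative_const[of h]]
    by simp
  \<comment> \<open>The chain rule asks for the derivative within the image of the half line, which
    is a subset of \<open>{0..}\<close> because \<open>h\<close> is nonnegative.\<close>
  moreover have "(z has_vector_derivative - G (z (t + h))) (at (t + h) within (\<lambda>t. t + h) ` {0..})"
  proof (rule has_vector_derivative_within_subset)
    show "(z has_vector_derivative - G (z (t + h))) (at (t + h) within {0..})"
      using assms \<open>0 \<le> t\<close> by (simp add: flow_def)
  qed (use assms in auto)
  ultimately show "((\<lambda>t. z (t + h)) has_vector_derivative - G (z (t + h))) (at t within {0..})"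
    using vector_diff_chain_within[of "\<lambda>t. t + h" 1 t "{0..}" z] by (simp add: o_def)
qed

text \<open>Lets estimates on difference quotients pass to the speed as \<open>h\<close> decreases
  to 0; one-sided increments cover \<open>t = 0\<close> as well.\<close>

lemma flow_difference_quotient:
  assumes "flow z" and "0 \<le> t"
  shows "((\<lambda>h. norm (z (t + h) - z t) / h) \<longlongrightarrow> norm (G (z t))) (at_right 0)"
proof -
  have "((\<lambda>h. z (h + t)) has_vector_derivative - G (z t)) (at 0 within {0..})"
    using flow_shift[OF assms, unfolded flow_def, rule_format, of 0] by simp
  then have "((\<lambda>h. z (h + t)) has_vector_derivative - G (z t)) (at 0 within {0<..})"
    by (rule has_vector_derivative_within_subset) auto
  then have "((\<lambda>h. norm ((z (h + t) - z t) - h *\<^sub>R (- G (z t))) / norm h) \<longlongrightarrow> 0) (at_right 0)"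
    by (simp add: has_vector_derivative_def has_derivative_iff_norm)
  moreover have "\<forall>\<^sub>F h in at_right 0. norm ((z (h + t) - z t) - h *\<^sub>R (- G (z t))) / norm h
      = norm ((1 / h) *\<^sub>R (z (t + h) - z t) - - G (z t))"
    using eventually_at_right_less[of 0]
  proof eventually_elim
    case (elim h)
    have "(1 / h) *\<^sub>R (z (t + h) - z t) - - G (z t) = (1 / h) *\<^sub>R ((z (h + t) - z t) - h *\<^sub>R (- G (z t)))"
      using elim by (simp add: scaleR_right_diff_distrib scaleR_add_right add.commute)
    then show ?case
      using elim by simp
  qed
  ultimately have "((\<lambda>h. norm ((1 / h) *\<^sub>R (z (t + h) - z t) - - G (z t))) \<longlongrightarrow> 0) (at_right 0)"
    by (rule Lim_transform_eventually)
  then have "((\<lambda>h. (1 / h) *\<^sub>R (z (t + h) - z t)) \<longlongrightarrow> - G (z t)) (at_right 0)"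
    by (simp only: tendsto_norm_zero_iff Lim_null[of _ "- G (z t)"])
  then have "((\<lambda>h. norm ((1 / h) *\<^sub>R (z (t + h) - z t))) \<longlongrightarrow> norm (- G (z t))) (at_right 0)"
    by (rule tendsto_norm)
  moreover have "\<forall>\<^sub>F h in at_right 0. norm ((1 / h) *\<^sub>R (z (t + h) - z t)) = norm (z (t + h) - z t) / h"
    using eventually_at_right_less[of 0] by eventually_elim simp
  ultimately show ?thesis
    unfolding norm_minus_cancel by (rule Lim_transform_eventually)
qed

text \<open>A translate of a flow is again a flow, so the distance between the two is nonincreasing;
  dividing it by \<open>h\<close> and letting \<open>h\<close> tend to 0 gives the speed.\<close>

lemma speed_decreasing:
  assumes "flow z" and "0 \<le> s" and "s \<le> t"
  shows "norm (G (z t)) \<le> norm (G (z s))"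
proof (rule tendsto_le[OF trivial_limit_at_right_real])
  show "((\<lambda>h. norm (z (t + h) - z t) / h) \<longlongrightarrow> norm (G (z t))) (at_right 0)"
    and "((\<lambda>h. norm (z (s + h) - z s) / h) \<longlongrightarrow> norm (G (z s))) (at_right 0)"
    using assms by (auto intro: flow_difference_quotient)
  have "\<forall>\<^sub>F h in at_right (0::real). 0 < h"
    by (rule eventually_at_right_less)
  then show "\<forall>\<^sub>F h in at_right 0. norm (z (t + h) - z t) / h \<le> norm (z (s + h) - z s) / h"
    by eventually_elim
      (use assms flow_dist_decreasing[OF flow_shift assms(1)] in \<open>simp add: divide_right_mono\<close>)
qed

lemma flow_increment:
  assumes "flow z" and "0 \<le> t" and "0 \<le> h"
  shows "norm (z (t + h) - z t) \<le> norm (G (z 0)) * h"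
proof -
  have "norm (- G (z r)) \<le> norm (G (z 0))" if "t \<le> r" for r
    using speed_decreasing[OF assms(1), of 0 r] that assms by simp
  then have "norm (z (t + h) - z t) \<le> norm (G (z 0)) * ((t + h) - t)"
    using assms vector_derivative_norm_bound[of t "t + h" z "\<lambda>r. - G (z r)"]
    by (simp add: flow_def)
  then show ?thesis by simp
qed

end

text \<open>The equilibrium is a parameter, so that the gap estimate can be instantiated at every
  saddle point for one and the same trajectory.\<close>

locale strongly_monotone_saddle_trajectory = strongly_monotone_saddle_flow +
  fixes z :: "real \<Rightarrow> 'a \<times> 'b" and p :: "'a \<times> 'b"
  assumes trajectory: "flow z" and equilibrium: "G p = 0"
begin

lemma dist_equilibrium_decreasing:
  "0 \<le> s \<Longrightarrow> s \<le> t \<Longrightarrow> norm (z t - p) \<le> norm (z s - p)"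
  using flow_dist_decreasing[OF trajectory flow_const[OF equilibrium]] .

lemma K_equilibrium: "K (fst p) = c"
  using equilibrium by (simp add: G_def zero_prod_def)

lemma F_equilibrium: "F (fst p) + K' (snd p) = 0"
  using equilibrium by (simp add: G_def zero_prod_def)

text \<open>Feasibility of \<open>p\<close> turns \<open>K (fst (z t)) - c\<close> into the image of
  the primal error, so the dual velocity is small with that error and lies in the range of
  \<open>K\<close>.\<close>

lemma snd_derivative:
  assumes "0 \<le> t"
  shows "((\<lambda>t. snd (z t)) has_vector_derivative K (fst (z t) - fst p)) (at t within {0..})"
proof -
  interpret K: bounded_linear K by (rule bounded_linear)
  have "((\<lambda>t. snd (z t)) has_vector_derivative snd (- G (z t))) (at t within {0..})"
    using trajectory assms
    by (intro bounded_linear.has_vector_derivative[OF bounded_linear_snd]) (auto simp: flow_def)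
  then show ?thesis
    by (simp add: G_def K.diff K_equilibrium)
qed

text \<open>During a time \<open>h\<close> the primal error grows by at most
  \<open>norm (G (z 0)) * h\<close>, the initial speed bounding all later ones; this bounds the dual
  velocity on the whole interval.\<close>

lemma snd_increment:
  assumes k: "\<And>v. norm (K v) \<le> k * norm v" "0 \<le> k" and "0 \<le> t" and "0 \<le> h"
  shows "norm (snd (z (t + h)) - snd (z t)) \<le> k * (norm (fst (z t) - fst p) + norm (G (z 0)) * h) * h"
proof -
  let ?b = "k * (norm (fst (z t) - fst p) + norm (G (z 0)) * h)"
  have "norm (K (fst (z r) - fst p)) \<le> ?b" if r: "t \<le> r" "r \<le> t + h" for r
  proof -
    have "norm (fst (z r) - fst (z t)) \<le> norm (z (t + (r - t)) - z t)"
      using fst_norm_le[of "z r - z t"] by simp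
    also have "\<dots> \<le> norm (G (z 0)) * (r - t)"
      using flow_increment[OF trajectory, of t "r - t"] r assms by simp
    also have "\<dots> \<le> norm (G (z 0)) * h"
      using r by (simp add: mult_left_mono)
    finally have "norm (fst (z r) - fst p) \<le> norm (fst (z t) - fst p) + norm (G (z 0)) * h"
      using norm_triangle_ineq[of "fst (z r) - fst (z t)" "fst (z t) - fst p"] by simp
    then show ?thesis
      using k(1)[of "fst (z r) - fst p"] k(2) by (meson mult_left_mono order_trans)
  qed
  then have "norm (snd (z (t + h)) - snd (z t)) \<le> ?b * ((t + h) - t)"
    using vector_derivative_norm_bound[OF _ _ snd_derivative, of t "t + h"] assms by simp
  then show ?thesis by simp
qed

text \<open>
  The trajectory need not be twice differentiable, so difference quotients stand in for the
  derivative of the speed: the squared primal speed is dissipated by the distance between the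
  trajectory and its translate, and the dual speed \<open>K (u - fst p)\<close> is controlled by the dissipation
  of the distance to the equilibrium.
\<close>

lemma speed_integral_estimate:
  assumes k: "\<And>v. norm (K v) \<le> k * norm v" "0 \<le> k" and "0 \<le> s" and "s \<le> t"
  defines "V \<equiv> \<lambda>t. (norm (G (z t)))\<^sup>2 / (2 * \<alpha>) + (k\<^sup>2 / \<alpha>) * (norm (z t - p))\<^sup>2"
  shows "(t - s) * (norm (G (z t)))\<^sup>2 \<le> V s - V t"
proof -
  define M where "M = norm (G (z 0))"
  define D where "D h t = (norm (z (t + h) - z t) / h)\<^sup>2" for h t
  \<comment> \<open>The weights fit the dissipation: \<open>1 / (2 * \<alpha>)\<close> makes the
    first term lose at least the squared primal quotient, and \<open>k\<^sup>2 / \<alpha>\<close>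
    makes the second lose \<open>2 * k\<^sup>2\<close> times the squared primal error, which
    dominates the dual quotient up to a term of order \<open>h\<^sup>2\<close>.\<close>
  define Vh where "Vh h t = D h t / (2 * \<alpha>) + (k\<^sup>2 / \<alpha>) * (norm (z t - p))\<^sup>2" for h t
  have D_lim: "((\<lambda>h. D h r) \<longlongrightarrow> (norm (G (z r)))\<^sup>2) (at_right 0)" if "0 \<le> r" for r
    unfolding D_def by (intro tendsto_intros flow_difference_quotient trajectory that)
  then have Vh_lim: "((\<lambda>h. Vh h r) \<longlongrightarrow> V r) (at_right 0)" if "0 \<le> r" for r
    unfolding Vh_def V_def using that \<alpha>_pos by (intro tendsto_intros) auto
  have est: "Vh h t - Vh h s \<le> (2 * k\<^sup>2 * M\<^sup>2 * h\<^sup>2 - D h t) * (t - s)" if h: "0 < h" for h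
  proof (rule derivative_upper_bound[OF \<open>0 \<le> s\<close> \<open>s \<le> t\<close>])
    let ?e = "\<lambda>r. (- 2 * ((G (z (r + h)) - G (z r)) \<bullet> (z (r + h) - z r)) / h\<^sup>2) / (2 * \<alpha>)
        + (k\<^sup>2 / \<alpha>) * (- 2 * ((G (z r) - G p) \<bullet> (z r - p)))"
    show "(Vh h has_real_derivative ?e r) (at r within {0..})" if "0 \<le> r" for r
    proof -
      note d1 = dist_sq_derivative[OF flow_shift[OF trajectory, of h] trajectory that]
      note d2 = dist_sq_derivative[OF trajectory flow_const[OF equilibrium] that]
      show ?thesis
        unfolding Vh_def D_def power_divide
        by (intro DERIV_add DERIV_cdivide DERIV_cmult d1 d2) (use h in simp)
    qed
    show "?e r \<le> 2 * k\<^sup>2 * M\<^sup>2 * h\<^sup>2 - D h t" if r: "s \<le> r" "r \<le> t" for r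
    proof -
      let ?du = "norm (fst (z (r + h)) - fst (z r))" and ?dl = "norm (snd (z (r + h)) - snd (z r))"
      let ?u = "norm (fst (z r) - fst p)"
      have r0: "0 \<le> r" using r \<open>0 \<le> s\<close> by simp
      \<comment> \<open>As \<open>D h\<close> is nonincreasing in time, its value at the right end
        \<open>t\<close> serves as a constant lower bound on the interval.\<close>
      have "norm (z (t + h) - z t) \<le> norm (z (r + h) - z r)"
        using flow_dist_decreasing[OF flow_shift[OF trajectory, of h] trajectory r0 r(2)] h by simp
      then have "D h t \<le> D h r"
        unfolding D_def using h by (intro power_mono divide_right_mono) auto
      also have "D h r = ?du\<^sup>2 / h\<^sup>2 + (?dl / h)\<^sup>2"
        by (simp add: D_def norm_prod_def power_divide add_divide_distrib)
      also have "(?dl / h)\<^sup>2 \<le> (k * (?u + M * h))\<^sup>2"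
        using snd_increment[OF k r0, of h] h
        by (intro power_mono) (auto simp: M_def pos_divide_le_eq)
      also have "\<dots> = k\<^sup>2 * (?u + M * h)\<^sup>2"
        by (rule power_mult_distrib)
      also have "\<dots> \<le> k\<^sup>2 * (2 * ?u\<^sup>2 + 2 * (M * h)\<^sup>2)"
      proof (rule mult_left_mono)
        have "0 \<le> (?u - M * h)\<^sup>2" by simp
        then show "(?u + M * h)\<^sup>2 \<le> 2 * ?u\<^sup>2 + 2 * (M * h)\<^sup>2"
          by (simp add: power2_diff power2_sum)
      qed simp
      also have "\<dots> = 2 * k\<^sup>2 * ?u\<^sup>2 + 2 * k\<^sup>2 * M\<^sup>2 * h\<^sup>2"
        by (simp add: power_mult_distrib algebra_simps)
      finally have "D h t \<le> ?du\<^sup>2 / h\<^sup>2 + 2 * k\<^sup>2 * ?u\<^sup>2 + 2 * k\<^sup>2 * M\<^sup>2 * h\<^sup>2"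
        by simp
      moreover have "(- 2 * ((G (z (r + h)) - G (z r)) \<bullet> (z (r + h) - z r)) / h\<^sup>2) / (2 * \<alpha>) \<le> - (?du\<^sup>2 / h\<^sup>2)"
        using G_strongly_monotone_fst[of "z (r + h)" "z r"] \<alpha>_pos h
        by (simp add: field_simps)
      moreover have "(k\<^sup>2 / \<alpha>) * (- 2 * ((G (z r) - G p) \<bullet> (z r - p))) \<le> - 2 * k\<^sup>2 * ?u\<^sup>2"
      proof -
        have "(k\<^sup>2 / \<alpha>) * (\<alpha> * ?u\<^sup>2) \<le> (k\<^sup>2 / \<alpha>) * ((G (z r) - G p) \<bullet> (z r - p))"
          using \<alpha>_pos by (intro mult_left_mono G_strongly_monotone_fst) simp
        moreover have "(k\<^sup>2 / \<alpha>) * (\<alpha> * ?u\<^sup>2) = k\<^sup>2 * ?u\<^sup>2"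
          using \<alpha>_pos by simp
        ultimately show ?thesis by linarith
      qed
      ultimately show ?thesis by linarith
    qed
  qed
  have "V t - V s \<le> (2 * k\<^sup>2 * M\<^sup>2 * 0\<^sup>2 - (norm (G (z t)))\<^sup>2) * (t - s)"
  proof (rule tendsto_le[OF trivial_limit_at_right_real])
    show "((\<lambda>h. (2 * k\<^sup>2 * M\<^sup>2 * h\<^sup>2 - D h t) * (t - s)) \<longlongrightarrow>
        (2 * k\<^sup>2 * M\<^sup>2 * 0\<^sup>2 - (norm (G (z t)))\<^sup>2) * (t - s)) (at_right 0)"
      using assms by (intro tendsto_intros D_lim) auto
    show "((\<lambda>h. Vh h t - Vh h s) \<longlongrightarrow> V t - V s) (at_right 0)"
      using assms by (intro tendsto_intros Vh_lim) auto
    have "\<forall>\<^sub>F h in at_right (0::real). 0 < h"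
      by (rule eventually_at_right_less)
    then show "\<forall>\<^sub>F h in at_right 0. Vh h t - Vh h s \<le> (2 * k\<^sup>2 * M\<^sup>2 * h\<^sup>2 - D h t) * (t - s)"
      by eventually_elim (rule est)
  qed
  then show ?thesis
    by (simp add: algebra_simps)
qed

text \<open>\<open>V\<close> is nonincreasing and nonnegative, hence convergent. The integral
  estimate from \<open>t/2\<close> to \<open>t\<close> bounds the quantity by twice the drop of
  \<open>V\<close> there, which tends to 0.\<close>

lemma speed_sq_times_time_tendsto_0:
  "((\<lambda>t. t * (norm (G (z t)))\<^sup>2) \<longlongrightarrow> 0) at_top"
proof -
  obtain k where k: "0 \<le> k" "\<And>v. norm (K v) \<le> k * norm v"
    using bounded_linear.nonneg_bounded[OF bounded_linear] by (auto simp: mult.commute)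
  define V where "V t = (norm (G (z t)))\<^sup>2 / (2 * \<alpha>) + (k\<^sup>2 / \<alpha>) * (norm (z t - p))\<^sup>2" for t
  have est: "(t - s) * (norm (G (z t)))\<^sup>2 \<le> V s - V t" if "0 \<le> s" "s \<le> t" for s t
    unfolding V_def using speed_integral_estimate[OF k(2,1) that] .
  have "V t \<le> V s" if "0 \<le> s" "s \<le> t" for s t
  proof -
    have "0 \<le> (t - s) * (norm (G (z t)))\<^sup>2"
      using that by simp
    with est[OF that] show ?thesis by linarith
  qed
  moreover have "0 \<le> V t" for t
    using \<alpha>_pos by (simp add: V_def)
  ultimately obtain v where v: "(V \<longlongrightarrow> v) at_top"
    using antimono_bounded_below_tendsto by blast
  have "filterlim (\<lambda>t. (1/2) * t :: real) at_top at_top"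
    by (rule filterlim_tendsto_pos_mult_at_top[OF tendsto_const _ filterlim_ident]) simp
  then have "((\<lambda>t. V ((1/2) * t)) \<longlongrightarrow> v) at_top"
    by (rule filterlim_compose[OF v])
  then have "((\<lambda>t. 2 * (V ((1/2) * t) - V t)) \<longlongrightarrow> 2 * (v - v)) at_top"
    by (intro tendsto_intros v)
  then have lim: "((\<lambda>t. 2 * (V ((1/2) * t) - V t)) \<longlongrightarrow> 0) at_top"
    by simp
  show ?thesis
  proof (rule tendsto_sandwich[OF _ _ tendsto_const lim])
    have "\<forall>\<^sub>F t in at_top. (0::real) \<le> t"
      by (rule eventually_ge_at_top)
    then show "\<forall>\<^sub>F t in at_top. 0 \<le> t * (norm (G (z t)))\<^sup>2"
      by eventually_elim simp
    have "\<forall>\<^sub>F t in at_top. (0::real) \<le> t"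
      by (rule eventually_ge_at_top)
    then show "\<forall>\<^sub>F t in at_top. t * (norm (G (z t)))\<^sup>2 \<le> 2 * (V ((1/2) * t) - V t)"
    proof eventually_elim
      case (elim t)
      then show ?case
        using est[of "(1/2) * t" t] by (simp add: algebra_simps)
    qed
  qed
qed

section \<open>Decay of the speed and primal convergence\<close>

lemma speed_smallo: "(\<lambda>t. norm (G (z t))) \<in> o[at_top](\<lambda>t. 1 / sqrt t)"
proof (rule smalloI_tendsto)
  have "((\<lambda>t. sqrt (t * (norm (G (z t)))\<^sup>2)) \<longlongrightarrow> sqrt 0) at_top"
    by (intro tendsto_intros speed_sq_times_time_tendsto_0)
  then show "((\<lambda>t. norm (G (z t)) / (1 / sqrt t)) \<longlongrightarrow> 0) at_top"
    by (simp add: real_sqrt_mult mult.commute)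
  show "\<forall>\<^sub>F t in at_top. 1 / sqrt t \<noteq> 0"
    using eventually_gt_at_top[of "0::real"] by eventually_elim simp
qed

lemma speed_tendsto_0: "((\<lambda>t. G (z t)) \<longlongrightarrow> 0) at_top"
proof -
  have "((\<lambda>t. 1 / sqrt t) \<longlongrightarrow> 0) at_top"
    by (intro tendsto_divide_0[OF tendsto_const] filterlim_at_top_imp_at_infinity sqrt_at_top)
  with smalloD_tendsto[OF speed_smallo]
  have "((\<lambda>t. norm (G (z t)) / (1 / sqrt t) * (1 / sqrt t)) \<longlongrightarrow> 0 * 0) at_top"
    by (rule tendsto_mult)
  moreover have "\<forall>\<^sub>F t in at_top. norm (G (z t)) / (1 / sqrt t) * (1 / sqrt t) = norm (G (z t))"
    using eventually_gt_at_top[of "0::real"] by eventually_elim simp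
  ultimately have "((\<lambda>t. norm (G (z t))) \<longlongrightarrow> 0) at_top"
    using Lim_transform_eventually by fastforce
  then show ?thesis
    by (rule tendsto_norm_zero_cancel)
qed

text \<open>Cauchy-Schwarz, with \<open>G p = 0\<close> and the distance to \<open>p\<close> never
  exceeding its initial value. The left side controls both the primal error and the duality gap, so
  both inherit the decay of the speed.\<close>

lemma inner_speed_le:
  assumes "0 \<le> t"
  shows "(G (z t) - G p) \<bullet> (z t - p) \<le> norm (z 0 - p) * norm (G (z t))"
proof -
  have "(G (z t) - G p) \<bullet> (z t - p) \<le> norm (G (z t)) * norm (z t - p)"
    using norm_cauchy_schwarz[of "G (z t)" "z t - p"] by (simp add: equilibrium)
  also have "\<dots> \<le> norm (G (z t)) * norm (z 0 - p)"
    using dist_equilibrium_decreasing[of 0 t] assms by (simp add: mult_left_mono)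
  finally show ?thesis by (simp add: mult.commute)
qed

lemma fst_tendsto: "((\<lambda>t. fst (z t)) \<longlongrightarrow> fst p) at_top"
proof -
  have "((\<lambda>t. norm (z 0 - p) * norm (G (z t)) / \<alpha>) \<longlongrightarrow> norm (z 0 - p) * norm (0 :: 'a \<times> 'b) / \<alpha>) at_top"
    using \<alpha>_pos by (intro tendsto_intros speed_tendsto_0) auto
  then have lim: "((\<lambda>t. norm (z 0 - p) * norm (G (z t)) / \<alpha>) \<longlongrightarrow> 0) at_top"
    by simp
  have "((\<lambda>t. (norm (fst (z t) - fst p))\<^sup>2) \<longlongrightarrow> 0) at_top"
  proof (rule tendsto_sandwich[OF _ _ tendsto_const lim])
    show "\<forall>\<^sub>F t in at_top. (norm (fst (z t) - fst p))\<^sup>2 \<le> norm (z 0 - p) * norm (G (z t)) / \<alpha>"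
      using eventually_ge_at_top[of 0]
    proof eventually_elim
      case (elim t)
      then show ?case
        using order_trans[OF G_strongly_monotone_fst inner_speed_le[OF elim]] \<alpha>_pos
        by (simp add: pos_le_divide_eq mult.commute)
    qed
  qed simp
  then have "((\<lambda>t. sqrt ((norm (fst (z t) - fst p))\<^sup>2)) \<longlongrightarrow> sqrt 0) at_top"
    by (rule tendsto_real_sqrt)
  then show ?thesis
    by (simp add: tendsto_norm_zero_iff LIM_zero_iff)
qed

text \<open>The limit \<open>m\<close> is the projection of the initial multiplier onto the affine
  set of multipliers with the same image under \<open>K'\<close> as \<open>snd p\<close>. The dual
  space splits into the closed range of \<open>K\<close> and the kernel of \<open>K'\<close>, and
  the convergence is tested on each part.\<close>

lemma snd_weak_limit:
  assumes "isCont F (fst p)"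
  obtains m where "\<And>n. K' n = 0 \<Longrightarrow> (snd (z 0) - m) \<bullet> n = 0" and "K' m = K' (snd p)"
    and "\<And>w. ((\<lambda>t. snd (z t) \<bullet> w) \<longlongrightarrow> m \<bullet> w) at_top"
proof -
  interpret K: bounded_linear K by (rule bounded_linear)
  have K'_eq_iff: "K' a = K' b \<longleftrightarrow> (\<forall>v. (a - b) \<bullet> K v = 0)" for a b
  proof -
    have "K' a = K' b \<longleftrightarrow> (\<forall>v. v \<bullet> K' (a - b) = 0)"
      using vector_eq_ldot[of "K' (a - b)" 0] by (simp add: K'_diff)
    then show ?thesis
      by (simp add: adjoint[symmetric] inner_commute)
  qed
  define S where "S = closure (range K)"
  have S: "closed S" "subspace S"
    by (simp_all add: S_def closure_subspace K.linear_axioms linear_subspace_image)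
  have range_S: "K v \<in> S" for v
    unfolding S_def by (rule subsetD[OF closure_subset rangeI])
  have orth: "s \<bullet> n = 0" if "K' n = 0" "s \<in> S" for n s
  proof -
    have "range K \<subseteq> {s. s \<bullet> n = 0}"
      using adjoint that(1) by auto
    moreover have "closed {s. s \<bullet> n = 0}"
      by (intro closed_Collect_eq continuous_intros)
    ultimately have "S \<subseteq> {s. s \<bullet> n = 0}"
      unfolding S_def by (rule closure_minimal)
    then show ?thesis using that(2) by blast
  qed
  \<comment> \<open>Subtracting from the initial multiplier the \<open>S\<close>-component of its
    offset from \<open>snd p\<close> keeps its component in the kernel of \<open>K'\<close> and
    gives it the image of \<open>snd p\<close> under \<open>K'\<close>.\<close>
  obtain s0 where s0: "s0 \<in> S" "\<And>s. s \<in> S \<Longrightarrow> (snd (z 0) - snd p - s0) \<bullet> s = 0"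
    using closed_subspace_orthogonal_decomposition[OF S] by blast
  define m where "m = snd (z 0) - s0"
  have m_orth: "(snd (z 0) - m) \<bullet> n = 0" if "K' n = 0" for n
    using orth[OF that s0(1)] by (simp add: m_def)
  have K'm: "K' m = K' (snd p)"
    unfolding K'_eq_iff
  proof
    fix v
    have "m - snd p = snd (z 0) - snd p - s0"
      by (simp add: m_def)
    then show "(m - snd p) \<bullet> K v = 0"
      by (simp only: s0(2)[OF range_S])
  qed
  \<comment> \<open>The dual velocity lies in the range of \<open>K\<close>, which is orthogonal to
    \<open>n\<close>; the inner product is therefore constant, with initial value 0.\<close>
  have const: "(snd (z t) - m) \<bullet> n = 0" if n: "K' n = 0" and t: "0 \<le> t" for n t
  proof -
    have "norm ((snd (z t) - m) \<bullet> n - (snd (z 0) - m) \<bullet> n) \<le> 0 * (t - 0)"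
    proof (rule vector_derivative_norm_bound)
      fix r :: real assume r: "0 \<le> r"
      have "((\<lambda>r. snd (z r) - m) has_vector_derivative K (fst (z r) - fst p) - 0) (at r within {0..})"
        by (intro has_vector_derivative_diff snd_derivative r has_vector_derivative_const)
      then show "((\<lambda>r. (snd (z r) - m) \<bullet> n) has_vector_derivative (K (fst (z r) - fst p) - 0) \<bullet> n)
          (at r within {0..})"
        by (rule bounded_linear.has_vector_derivative[OF bounded_linear_inner_left])
    qed (use t n adjoint in auto)
    then show ?thesis
      using m_orth[OF n] by simp
  qed
  have bounded: "\<forall>\<^sub>F t in at_top. norm (snd (z t) - m) \<le> norm (z 0 - p) + norm (snd p - m)"
    using eventually_ge_at_top[of 0]
  proof eventually_elim
    case (elim t)
    have "norm (snd (z t) - snd p) \<le> norm (z t - p)"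
      by (metis norm_snd_le prod.collapse snd_diff)
    also have "\<dots> \<le> norm (z 0 - p)"
      using dist_equilibrium_decreasing[of 0 t] elim by simp
    finally show ?case
      using norm_triangle_ineq[of "snd (z t) - snd p" "snd p - m"] by simp
  qed
  \<comment> \<open>Testing against \<open>K v\<close> moves the question to \<open>K'\<close> of
    the multiplier, which the first equation expresses by the vanishing speed and by
    \<open>F\<close> along the convergent primal part.\<close>
  have range: "((\<lambda>t. (snd (z t) - m) \<bullet> s) \<longlongrightarrow> 0) at_top" if "s \<in> range K" for s
  proof -
    from that obtain v where v: "s = K v" by blast
    have "(snd (z t) - m) \<bullet> s = v \<bullet> (fst (G (z t)) - (F (fst (z t)) - F (fst p)))" for t
    proof -
      have "(snd (z t) - m) \<bullet> s = v \<bullet> K' (snd (z t)) - v \<bullet> K' m"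
        unfolding v adjoint[symmetric] by (simp add: inner_simps inner_commute)
      also have "K' m = - F (fst p)"
        using F_equilibrium K'm by (simp add: eq_neg_iff_add_eq_0 add.commute)
      finally show ?thesis
        by (simp add: G_def inner_simps)
    qed
    moreover have "((\<lambda>t. v \<bullet> (fst (G (z t)) - (F (fst (z t)) - F (fst p)))) \<longlongrightarrow>
        v \<bullet> (fst (0 :: 'a \<times> 'b) - (F (fst p) - F (fst p)))) at_top"
      by (intro tendsto_intros speed_tendsto_0 isCont_tendsto_compose[OF assms] fst_tendsto)
    ultimately show ?thesis by simp
  qed
  have "((\<lambda>t. snd (z t) \<bullet> w) \<longlongrightarrow> m \<bullet> w) at_top" for w
  proof -
    \<comment> \<open>The remainder \<open>w - s\<close> lies in the kernel of \<open>K'\<close>, so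
      \<open>const\<close> removes it and only the component in \<open>S\<close> is left to
      treat.\<close>
    obtain s where s: "s \<in> S" "\<And>s'. s' \<in> S \<Longrightarrow> (w - s) \<bullet> s' = 0"
      using closed_subspace_orthogonal_decomposition[OF S] by blast
    have "(w - s) \<bullet> K v = 0" for v
      by (rule s(2)[OF range_S])
    then have "K' (w - s) = 0"
      using K'_eq_iff[of w s] by (simp add: K'_diff)
    from const[OF this] have "(snd (z t) - m) \<bullet> s = (snd (z t) - m) \<bullet> w" if "0 \<le> t" for t
      using that by (simp add: inner_diff_right)
    then have "\<forall>\<^sub>F t in at_top. (snd (z t) - m) \<bullet> s = (snd (z t) - m) \<bullet> w"
      by (rule eventually_mono[OF eventually_ge_at_top[of 0]])
    moreover have "((\<lambda>t. (snd (z t) - m) \<bullet> s) \<longlongrightarrow> 0) at_top"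
      using tendsto_inner_closure[OF s(1)[unfolded S_def] bounded range] .
    ultimately have "((\<lambda>t. (snd (z t) - m) \<bullet> w) \<longlongrightarrow> 0) at_top"
      by (blast intro: Lim_transform_eventually)
    then show ?thesis
      by (simp add: inner_diff_left LIM_zero_iff)
  qed
  with m_orth K'm show thesis by (rule that)
qed

text \<open>The expression is the gap, since feasibility of \<open>fst p\<close> removes the
  multiplier of the trajectory from the second Lagrangian. Convexity at both points places the gap
  between 0 and the monotonicity expression bounded in \<open>inner_speed_le\<close>.\<close>

lemma duality_gap_smallo:
  assumes "convex_on UNIV H" and "\<And>u. GDERIV H u :> F u"
  shows "(\<lambda>t. H (fst (z t)) + snd p \<bullet> (K (fst (z t)) - c) - H (fst p)) \<in> o[at_top](\<lambda>t. 1 / sqrt t)"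
proof (rule landau_o.big_small_trans[OF bigoI speed_smallo])
  interpret K: bounded_linear K by (rule bounded_linear)
  show "\<forall>\<^sub>F t in at_top. norm (H (fst (z t)) + snd p \<bullet> (K (fst (z t)) - c) - H (fst p))
      \<le> norm (z 0 - p) * norm (norm (G (z t)))"
    using eventually_ge_at_top[of 0]
  proof eventually_elim
    case (elim t)
    let ?u = "fst (z t)" and ?v = "fst p"
    \<comment> \<open>Stationarity at \<open>p\<close> turns the coupling term into minus the linear
      part of \<open>H\<close> at \<open>fst p\<close>, so the gap is the Bregman distance of
      \<open>H\<close>.\<close>
    have dual: "snd p \<bullet> (K ?u - c) = - (F ?v \<bullet> (?u - ?v))"
    proof -
      have "snd p \<bullet> (K ?u - c) = (?u - ?v) \<bullet> K' (snd p)"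
        unfolding adjoint[symmetric] by (simp add: K.diff K_equilibrium inner_commute)
      also have "K' (snd p) = - F ?v"
        using F_equilibrium by (simp add: eq_neg_iff_add_eq_0 add.commute)
      finally show ?thesis
        by (simp add: inner_commute)
    qed
    have "H ?v + F ?v \<bullet> (?u - ?v) \<le> H ?u" and "H ?u + F ?u \<bullet> (?v - ?u) \<le> H ?v"
      using convex_above_gradient[OF assms(1) assms(2)] by blast+
    moreover have "F ?u \<bullet> (?v - ?u) = - (F ?u \<bullet> (?u - ?v))"
      by (simp add: inner_diff_right)
    moreover have "F ?u \<bullet> (?u - ?v) - F ?v \<bullet> (?u - ?v) \<le> norm (z 0 - p) * norm (G (z t))"
      using inner_speed_le[OF elim] unfolding inner_G_diff by (simp only: inner_diff_left)
    ultimately show ?case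
      unfolding dual by simp
  qed
qed

end

section \<open>The generalized Arrow--Hurwicz system\<close>

lemma lipschitz_on_bounded_sets_isCont:
  assumes "lipschitz_on_bounded_sets T"
  shows "isCont T u"
proof -
  obtain k where "k-lipschitz_on (ball u 1) T"
    using assms bounded_ball[of u 1] unfolding lipschitz_on_bounded_sets_def by blast
  then have "continuous_on (ball u 1) T"
    by (rule lipschitz_on_continuous_on)
  then show ?thesis
    by (simp add: continuous_on_eq_continuous_at)
qed

lemma convex_on_separable_sum:
  assumes "convex_on UNIV f" and "convex_on UNIV g"
  shows "convex_on UNIV (\<lambda>(u, v). f u + g v)"
proof (rule convex_onI)
  fix t :: real and p q assume "0 < t" "t < 1"
  then show "(case (1 - t) *\<^sub>R p + t *\<^sub>R q of (u, v) \<Rightarrow> f u + g v)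
      \<le> (1 - t) * (case p of (u, v) \<Rightarrow> f u + g v) + t * (case q of (u, v) \<Rightarrow> f u + g v)"
    using convex_onD[OF assms(1), of t "fst p" "fst q"] convex_onD[OF assms(2), of t "snd p" "snd q"]
    by (simp add: case_prod_beta algebra_simps)
qed simp

text \<open>Pythagoras gives minimality and uniqueness at once. Orthogonality can be asked with
  equality because the saddle points here differ only by elements of the kernel of
  \<open>K'\<close>.\<close>

lemma orth_proj_eqI:
  fixes a :: "'a::real_inner"
  assumes "p \<in> S" and orth: "\<And>q. q \<in> S \<Longrightarrow> (a - p) \<bullet> (q - p) = 0"
  shows "orth_proj S a = p"
proof -
  have pythagoras: "(dist a q)\<^sup>2 = (dist a p)\<^sup>2 + (dist p q)\<^sup>2" if "q \<in> S" for q
  proof -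
    have "(dist a q)\<^sup>2 = (norm ((a - p) - (q - p)))\<^sup>2"
      by (simp add: dist_norm)
    also have "\<dots> = (norm (a - p))\<^sup>2 + (norm (q - p))\<^sup>2 - 2 * ((a - p) \<bullet> (q - p))"
      unfolding power2_norm_eq_inner inner_diff_left[of "a - p"] inner_diff_right[of _ "a - p"]
      by (simp add: inner_commute[of "q - p" "a - p"])
    finally show ?thesis
      using orth[OF that] by (simp add: dist_norm norm_minus_commute)
  qed
  show ?thesis
    unfolding orth_proj_def
  proof (rule the_equality)
    have "dist a p \<le> dist a q" if "q \<in> S" for q
      by (rule power2_le_imp_le) (simp_all add: pythagoras[OF that])
    with assms(1) show "p \<in> S \<and> (\<forall>q\<in>S. dist a p \<le> dist a q)"
      by blast
  next
    fix q assume q: "q \<in> S \<and> (\<forall>q'\<in>S. dist a q \<le> dist a q')"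
    then have "(dist a q)\<^sup>2 \<le> (dist a p)\<^sup>2"
      using assms(1) by (simp add: power_mono)
    then have "(dist p q)\<^sup>2 \<le> 0"
      using pythagoras[of q] q by simp
    then show "q = p"
      by simp
  qed
qed

theorem theorem5p3:
  fixes f :: "'x::{real_inner, complete_space} \<Rightarrow> real"
    and g :: "'y::{real_inner, complete_space} \<Rightarrow> real"
    and A :: "'x \<Rightarrow> 'z::{real_inner, complete_space}"
    and B :: "'y \<Rightarrow> 'z"
    and c :: 'z
    and \<alpha> :: real
    and x :: "real \<Rightarrow> 'x" and y :: "real \<Rightarrow> 'y" and l :: "real \<Rightarrow> 'z"
    and x0 :: 'x and y0 :: 'y and l0 :: 'z
  defines "L \<equiv> lagrangian f g A B c"
  assumes "convex_on UNIV f" and "continuously_differentiable f"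
    and "lipschitz_on_bounded_sets (gradient f)"
    and "convex_on UNIV g" and "continuously_differentiable g"
    and "lipschitz_on_bounded_sets (gradient g)"
    and "bounded_linear A" and "bounded_linear B"
    and "\<alpha> > 0"
    and "strongly_monotone \<alpha> (gradient (\<lambda>(u, v). f u + g v))"
    and "saddle_points L \<noteq> {}"
    and "GAH_solution f g A B c x0 y0 l0 x y l"
  shows "(\<forall>(\<xi>, \<psi>, \<eta>) \<in> saddle_points L.
            (\<lambda>t. L (x t) (y t) \<eta> - L \<xi> \<psi> (l t)) \<in> o[at_top](\<lambda>t. 1 / sqrt t)) \<and>
         (\<lambda>t. norm (time_deriv x t, time_deriv y t, time_deriv l t)) \<in> o[at_top](\<lambda>t. 1 / sqrt t) \<and>
         orth_proj (saddle_points L) (x0, y0, l0) \<in> saddle_points L \<and>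
         converges_weakly (\<lambda>t. (x t, y t, l t)) (orth_proj (saddle_points L) (x0, y0, l0)) at_top"
proof -

  \<comment> \<open>Reduction to the abstract flow\<close>
  define H where "H = (\<lambda>(u, v). f u + g v)"
  define F where "F p = (gradient f (fst p), gradient g (snd p))" for p
  define K where "K p = A (fst p) + B (snd p)" for p
  define K' where "K' w = (adjoint A w, adjoint B w)" for w
  have L_eq: "L u v w = H (u, v) + w \<bullet> (K (u, v) - c)" for u v w
    by (simp add: L_def lagrangian_def H_def K_def)
  have convex_H: "convex_on UNIV H"
    unfolding H_def by (rule convex_on_separable_sum[OF assms(2,5)])
  have grad_H: "GDERIV H p :> F p" for p
    using GDERIV_separable_sum[OF GDERIV_gradient[OF assms(3)] GDERIV_gradient[OF assms(6)], of "fst p" "snd p"]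
    by (simp add: H_def F_def)
  then have "gradient H = F"
    by (simp add: fun_eq_iff gradient_eq)
  then have "strongly_monotone \<alpha> F"
    using assms(11) by (simp add: H_def)
  moreover have K_bl: "bounded_linear K"
    unfolding K_def
    by (intro bounded_linear_add bounded_linear_compose[OF assms(8)] bounded_linear_compose[OF assms(9)]
        bounded_linear_fst bounded_linear_snd)
  moreover have "K v \<bullet> w = v \<bullet> K' w" for v w
    by (simp add: K_def K'_def inner_prod_def inner_add_left
        adjoint_bounded_linear_works[OF assms(8)] adjoint_bounded_linear_works[OF assms(9)])
  ultimately interpret strongly_monotone_saddle_flow F K K' c \<alpha>
    using assms(10) by (simp add: strongly_monotone_saddle_flow_def)
  interpret K: bounded_linear K by (rule K_bl)

  \<comment> \<open>The triple is regrouped as a primal pair and a multiplier to match the type of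
    \<open>G\<close>.\<close>
  define z where "z t = ((x t, y t), l t)" for t
  have deriv: "(z has_vector_derivative ((time_deriv x t, time_deriv y t), time_deriv l t)) (at t within {0..})"
    and eqns: "((time_deriv x t, time_deriv y t), time_deriv l t) = - G (z t)" if t: "0 \<le> t" for t
  proof -
    obtain d where d: "((\<lambda>t. (x t, y t, l t)) has_vector_derivative d) (at t within {0..})"
      using assms(13) t unfolding GAH_solution_def C1_on_half_line_def by blast
    \<comment> \<open>Every \<open>t \<ge> 0\<close>, including 0, has a right neighbourhood in the
      half line; hence the derivative there is unique and \<open>time_deriv\<close> returns
      it.\<close>
    have not_bot: "at t within {0..} \<noteq> bot"
    proof -
      have "at_right t \<le> at t within {0..}"
        using t by (intro at_le) auto
      then show ?thesis
        using trivial_limit_at_right_real[of t] by (auto simp: bot_unique)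
    qed
    have x: "(x has_vector_derivative fst d) (at t within {0..})"
      using bounded_linear.has_vector_derivative[OF bounded_linear_fst d] by simp
    have yl: "((\<lambda>t. (y t, l t)) has_vector_derivative snd d) (at t within {0..})"
      using bounded_linear.has_vector_derivative[OF bounded_linear_snd d] by simp
    have y: "(y has_vector_derivative fst (snd d)) (at t within {0..})"
      using bounded_linear.has_vector_derivative[OF bounded_linear_fst yl] by simp
    have l: "(l has_vector_derivative snd (snd d)) (at t within {0..})"
      using bounded_linear.has_vector_derivative[OF bounded_linear_snd yl] by simp
    have td: "time_deriv x t = fst d" "time_deriv y t = fst (snd d)" "time_deriv l t = snd (snd d)"
      unfolding time_deriv_def by (rule vector_derivative_within[OF not_bot], fact)+
    show "(z has_vector_derivative ((time_deriv x t, time_deriv y t), time_deriv l t)) (at t within {0..})"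
      unfolding z_def td by (intro has_vector_derivative_Pair x y l)
    have "time_deriv x t + gradient f (x t) + adjoint A (l t) = 0"
      and "time_deriv y t + gradient g (y t) + adjoint B (l t) = 0"
      and "time_deriv l t + c - A (x t) - B (y t) = 0"
      using assms(13) t by (simp_all add: GAH_solution_def)
    then show "((time_deriv x t, time_deriv y t), time_deriv l t) = - G (z t)"
      by (simp add: G_def F_def K_def K'_def z_def eq_neg_iff_add_eq_0 algebra_simps)
  qed
  have flow_z: "flow z"
    unfolding flow_def using deriv eqns by simp

  \<comment> \<open>Saddle points, the weak limit and the projection\<close>
  have equilibrium: "G ((\<xi>, \<psi>), \<eta>) = 0" if "(\<xi>, \<psi>, \<eta>) \<in> saddle_points L" for \<xi> \<psi> \<eta>
  proof (rule saddle_imp_equilibrium[OF grad_H])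
    show "H (\<xi>, \<psi>) + w \<bullet> (K (\<xi>, \<psi>) - c) \<le> H (\<xi>, \<psi>) + \<eta> \<bullet> (K (\<xi>, \<psi>) - c)" for w
      using that unfolding saddle_points_def L_eq by blast
    show "H (\<xi>, \<psi>) + \<eta> \<bullet> (K (\<xi>, \<psi>) - c) \<le> H v + \<eta> \<bullet> (K v - c)" for v
      using that unfolding saddle_points_def L_eq by (cases v) blast
  qed
  have trajectory: "strongly_monotone_saddle_trajectory F K K' c \<alpha> z ((\<xi>, \<psi>), \<eta>)"
    if "(\<xi>, \<psi>, \<eta>) \<in> saddle_points L" for \<xi> \<psi> \<eta>
    by unfold_locales (use flow_z equilibrium[OF that] in auto)

  obtain \<xi> \<psi> \<eta> where saddle: "(\<xi>, \<psi>, \<eta>) \<in> saddle_points L"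
    using assms(12) by auto
  interpret T: strongly_monotone_saddle_trajectory F K K' c \<alpha> z "((\<xi>, \<psi>), \<eta>)"
    by (rule trajectory[OF saddle])
  have K_saddle: "K (\<xi>, \<psi>) = c"
    using T.K_equilibrium by simp

  have "isCont (\<lambda>p. (gradient f (fst p), gradient g (snd p))) (\<xi>, \<psi>)"
    by (intro continuous_Pair isCont_o2[OF isCont_fst[OF continuous_ident]]
        isCont_o2[OF isCont_snd[OF continuous_ident]] lipschitz_on_bounded_sets_isCont assms(4,7))
  then have "isCont F (\<xi>, \<psi>)"
    by (simp add: F_def[abs_def])
  then obtain m where m_orth: "\<And>n. K' n = 0 \<Longrightarrow> (l0 - m) \<bullet> n = 0" and K'm: "K' m = K' \<eta>"
    and weak: "\<And>w. ((\<lambda>t. l t \<bullet> w) \<longlongrightarrow> m \<bullet> w) at_top"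
    using T.snd_weak_limit assms(13) by (auto simp: z_def GAH_solution_def)

  have saddle_m: "(\<xi>, \<psi>, m) \<in> saddle_points L"
  proof -
    \<comment> \<open>With \<open>c = K (\<xi>, \<psi>)\<close> the residual is in the range of
      \<open>K\<close>, where \<open>m\<close> and \<open>\<eta>\<close> act alike. So both
      multipliers give the same Lagrangian as a function of the primal variables.\<close>
    have "m \<bullet> (K p - c) = \<eta> \<bullet> (K p - c)" for p
      using adjoint[of "p - (\<xi>, \<psi>)"] K'm
      by (simp add: K_saddle[symmetric] inner_commute flip: K.diff)
    then show ?thesis
      using saddle by (simp add: saddle_points_def L_eq K_saddle)
  qed
  have proj: "orth_proj (saddle_points L) (x0, y0, l0) = (\<xi>, \<psi>, m)"
  proof (rule orth_proj_eqI[OF saddle_m])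
    fix q assume "q \<in> saddle_points L"
    moreover obtain \<xi>' \<psi>' \<eta>' where q: "q = (\<xi>', \<psi>', \<eta>')"
      by (cases q)
    ultimately have eq: "G ((\<xi>', \<psi>'), \<eta>') = 0" "G ((\<xi>, \<psi>), m) = 0"
      using equilibrium saddle_m by auto
    have "(\<xi>', \<psi>') = (\<xi>, \<psi>)"
      using equilibrium_fst_unique[OF eq] by simp
    moreover have "K' (\<eta>' - m) = 0"
      using equilibrium_snd_diff[OF eq] by simp
    ultimately show "((x0, y0, l0) - (\<xi>, \<psi>, m)) \<bullet> (q - (\<xi>, \<psi>, m)) = 0"
      using m_orth by (simp add: q inner_prod_def)
  qed

  \<comment> \<open>Rates and weak convergence for the original system\<close>
  have "(\<lambda>t. L (x t) (y t) \<eta>' - L \<xi>' \<psi>' (l t)) \<in> o[at_top](\<lambda>t. 1 / sqrt t)"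
    if "(\<xi>', \<psi>', \<eta>') \<in> saddle_points L" for \<xi>' \<psi>' \<eta>'
  proof -
    interpret S: strongly_monotone_saddle_trajectory F K K' c \<alpha> z "((\<xi>', \<psi>'), \<eta>')"
      by (rule trajectory[OF that])
    show ?thesis
      using S.duality_gap_smallo[OF convex_H grad_H] S.K_equilibrium by (simp add: L_eq z_def)
  qed
  moreover have "(\<lambda>t. norm (time_deriv x t, time_deriv y t, time_deriv l t)) \<in> o[at_top](\<lambda>t. 1 / sqrt t)"
  proof -
    have "\<forall>\<^sub>F t in at_top. norm (time_deriv x t, time_deriv y t, time_deriv l t) = norm (G (z t))"
      using eventually_ge_at_top[of 0]
    proof eventually_elim
      case (elim t)
      have "norm (time_deriv x t, time_deriv y t, time_deriv l t)
          = norm ((time_deriv x t, time_deriv y t), time_deriv l t)"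
        by (simp add: norm_prod_def)
      then show ?case
        using eqns[OF elim] by simp
    qed
    then show ?thesis
      using T.speed_smallo by (simp add: landau_o.small.in_cong)
  qed
  moreover have "converges_weakly (\<lambda>t. (x t, y t, l t)) (\<xi>, \<psi>, m) at_top"
    unfolding converges_weakly_def
  proof (intro allI impI)
    fix \<phi> :: "'x \<times> 'y \<times> 'z \<Rightarrow> real" assume "bounded_linear \<phi>"
    then interpret \<phi>: bounded_linear \<phi> .
    \<comment> \<open>A functional on the product splits into a primal part, handled by strong
      convergence, and a dual part, which Riesz turns into an inner product covered by
      \<open>weak\<close>.\<close>
    have "bounded_linear (\<lambda>w. \<phi> (0, 0, w))"
      by (intro bounded_linear_compose[OF \<phi>.bounded_linear_axioms] bounded_linear_Pair
          bounded_linear_zero bounded_linear_ident)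
    then obtain r where r: "\<And>w. \<phi> (0, 0, w) = w \<bullet> r"
      using riesz_representation by blast
    have split: "\<phi> (a, b, w) = \<phi> (a, b, 0) + w \<bullet> r" for a b w
      using \<phi>.add[of "(a, b, 0)" "(0, 0, w)"] by (simp add: r)
    have "((\<lambda>t. (x t, y t)) \<longlongrightarrow> (\<xi>, \<psi>)) at_top"
      using T.fst_tendsto by (simp add: z_def)
    from tendsto_fst[OF this] tendsto_snd[OF this]
    have "((\<lambda>t. \<phi> (x t, y t, 0) + l t \<bullet> r) \<longlongrightarrow> \<phi> (\<xi>, \<psi>, 0) + m \<bullet> r) at_top"
      by (intro tendsto_add \<phi>.tendsto tendsto_Pair tendsto_const weak) simp_all
    then show "((\<lambda>t. \<phi> (x t, y t, l t)) \<longlongrightarrow> \<phi> (\<xi>, \<psi>, m)) at_top"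
      by (simp add: split[of _ _ "l _"] split[of _ _ m])
  qed
  ultimately show ?thesis
    using saddle_m by (auto simp: proj)
qed

end
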